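(* Let $B_3=\langle s_1,s_2\mid s_1s_2s_1=s_2s_1s_2\rangle$ be the braid group on $3$ strands. For $\lambda_1,\lambda_2\in\mathbb C^\times$ put $$A=\begin{pmatrix}\lambda_1&\lambda_1\\0&\lambda_2\end{pmatrix},\qquad B=\begin{pmatrix}\lambda_2&0\\-\lambda_2&\lambda_1\end{pmatrix}.$$ (a) Let $\varrho:B_3\to GL_2(\mathbb C)$ be an irreducible representation and let $\lambda_1,\lambda_2$ be the eigenvalues (with multiplicity) of $\varrho(s_1)$. Then $\lambda_1^2-\lambda_1\lambda_2+\lambda_2^2\neq0$ and $\varrho$ is equivalent to the representation $s_1\mapsto A$, $s_2\mapsto B$. (b) Conversely, if $\lambda_1,\lambda_2\in\mathbb C^\times$ satisfy $\lambda_1^2-\lambda_1\lambda_2+\lambda_2^2\neq0$, then $s_1\mapsto A$, $s_2\mapsto B$ defines an irreducible representation of $B_3$. *)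

theory Defs
  imports "HOL-Analysis.Analysis" "HOL-Algebra.Group"
    "HOL-Computational_Algebra.Polynomial"
begin

text \<open>
  A word over the alphabet \<open>'g\<close> is a list of letters \<open>(x, e)\<close>, where \<open>(x, True)\<close> stands for
  \<open>x\<close> and \<open>(x, False)\<close> for its formal inverse. The group presented by a set \<open>R\<close> of relations
  \<open>u = v\<close> has all elements of \<open>'g\<close> as generators and consists of the classes of words modulo the
  congruence generated by \<open>R\<close> and free cancellation.
\<close>

type_synonym 'g word = "('g \<times> bool) list"

inductive word_eq :: "('g word \<times> 'g word) set \<Rightarrow> 'g word \<Rightarrow> 'g word \<Rightarrow> bool"
  for R :: "('g word \<times> 'g word) set" where
  refl: "word_eq R w w"
| sym: "word_eq R v w \<Longrightarrow> word_eq R w v"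
| trans: "word_eq R u v \<Longrightarrow> word_eq R v w \<Longrightarrow> word_eq R u w"
| append: "word_eq R u u' \<Longrightarrow> word_eq R v v' \<Longrightarrow> word_eq R (u @ v) (u' @ v')"
| cancel: "word_eq R [(x, e), (x, \<not> e)] []"
| relation: "(u, v) \<in> R \<Longrightarrow> word_eq R u v"

definition word_class :: "('g word \<times> 'g word) set \<Rightarrow> 'g word \<Rightarrow> 'g word set" where
  "word_class R w = {v. word_eq R w v}"

definition presented_group :: "('g word \<times> 'g word) set \<Rightarrow> 'g word set monoid" where
  "presented_group R =
    \<lparr>carrier = range (word_class R),
     monoid.mult = (\<lambda>X Y. {w. \<exists>u\<in>X. \<exists>v\<in>Y. word_eq R (u @ v) w}),
     one = word_class R []\<rparr>"

lemma word_class_eq_iff: "word_class R u = word_class R v \<longleftrightarrow> word_eq R u v"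
  unfolding word_class_def by (blast intro: word_eq.refl word_eq.sym word_eq.trans)

lemma presented_group_simps:
  "carrier (presented_group R) = range (word_class R)"
  "one (presented_group R) = word_class R []"
  "word_class R u \<otimes>\<^bsub>presented_group R\<^esub> word_class R v = word_class R (u @ v)"
  unfolding presented_group_def word_class_def
  by (auto intro: word_eq.refl word_eq.trans word_eq.append)

lemma word_eq_inverse: "word_eq R (rev (map (apsnd Not) w) @ w) []"
proof (induction w)
  case Nil
  show ?case by (simp add: word_eq.refl)
next
  case (Cons a w)
  obtain x e where a: "a = (x, e)" by (cases a)
  let ?r = "rev (map (apsnd Not) w)"
  have "word_eq R ([(x, \<not> e), (x, e)] @ w) ([] @ w)"
    using word_eq.cancel[of R x "\<not> e"] by (intro word_eq.append word_eq.refl) simp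
  then have "word_eq R (?r @ [(x, \<not> e), (x, e)] @ w) (?r @ w)"
    by (intro word_eq.append word_eq.refl) simp
  then show ?case
    using Cons.IH by (auto simp: a intro: word_eq.trans)
qed

lemma group_presented_group: "group (presented_group R)"
proof (rule groupI)
  fix X assume "X \<in> carrier (presented_group R)"
  then obtain w where w: "X = word_class R w" by (auto simp: presented_group_simps)
  have "word_class R (rev (map (apsnd Not) w)) \<otimes>\<^bsub>presented_group R\<^esub> X = \<one>\<^bsub>presented_group R\<^esub>"
    using word_eq_inverse by (simp add: w presented_group_simps word_class_eq_iff)
  then show "\<exists>Y\<in>carrier (presented_group R). Y \<otimes>\<^bsub>presented_group R\<^esub> X = \<one>\<^bsub>presented_group R\<^esub>"
    by (auto simp: presented_group_simps)
qed (auto simp: presented_group_simps)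


datatype braid_gen = S1 | S2

definition braid3_rel :: "(braid_gen word \<times> braid_gen word) set" where
  "braid3_rel =
    {([(S1, True), (S2, True), (S1, True)], [(S2, True), (S1, True), (S2, True)])}"

definition B3 :: "braid_gen word set monoid" where
  "B3 = presented_group braid3_rel"

definition s1 :: "braid_gen word set" where
  "s1 = word_class braid3_rel [(S1, True)]"

definition s2 :: "braid_gen word set" where
  "s2 = word_class braid3_rel [(S2, True)]"


definition GL :: "('a::field^'n^'n) monoid" where
  "GL = \<lparr>carrier = {M. invertible M}, monoid.mult = (**), one = mat 1\<rparr>"

lemma group_GL: "group (GL :: ('a::field^'n^'n) monoid)"
proof (rule groupI)
  fix M :: "'a^'n^'n"
  assume "M \<in> carrier GL"
  then obtain N where N: "M ** N = mat 1" "N ** M = mat 1"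
    by (auto simp: GL_def invertible_def)
  then have "N \<in> carrier GL" by (auto simp: GL_def invertible_def)
  with N show "\<exists>N\<in>carrier GL. N \<otimes>\<^bsub>GL\<^esub> M = \<one>\<^bsub>GL\<^esub>"
    by (auto simp: GL_def)
next
  show "\<one>\<^bsub>GL\<^esub> \<in> carrier (GL :: ('a^'n^'n) monoid)"
    by (auto simp: GL_def invertible_def intro: exI[of _ "mat 1"])
qed (auto simp: GL_def invertible_mult matrix_mul_assoc)

text \<open>
  A representation of a group \<open>G\<close> on \<open>'a^'n\<close> is an element of \<^term>\<open>hom G GL\<close>. Index types are
  nonempty, so the space \<open>'a^'n\<close> is never zero.
\<close>

definition irreducible_rep :: "('g, 'b) monoid_scheme \<Rightarrow> ('g \<Rightarrow> 'a::field^'n^'n) \<Rightarrow> bool" where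
  "irreducible_rep G \<rho> \<longleftrightarrow>
    \<rho> \<in> hom G GL \<and>
    (\<forall>W. vec.subspace W \<and> (\<forall>g\<in>carrier G. \<forall>w\<in>W. \<rho> g *v w \<in> W) \<longrightarrow> W = {0} \<or> W = UNIV)"

definition equivalent_rep ::
  "('g, 'b) monoid_scheme \<Rightarrow> ('g \<Rightarrow> 'a::field^'n^'n) \<Rightarrow> ('g \<Rightarrow> 'a^'n^'n) \<Rightarrow> bool" where
  "equivalent_rep G \<rho> \<sigma> \<longleftrightarrow>
    (\<exists>P. invertible P \<and> (\<forall>g\<in>carrier G. \<sigma> g = P ** \<rho> g ** matrix_inv P))"

definition charpoly :: "'a::field^'n^'n \<Rightarrow> 'a poly" where
  "charpoly M = det (\<chi> i j. (if i = j then [:0, 1:] else 0) - [:M $ i $ j:])"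

definition eigenvalues :: "'a::field^'n^'n \<Rightarrow> 'a multiset" where
  "eigenvalues M = proots (charpoly M)"


definition matA :: "complex \<Rightarrow> complex \<Rightarrow> complex^2^2" where
  "matA l1 l2 = vector [vector [l1, l1], vector [0, l2]]"

definition matB :: "complex \<Rightarrow> complex \<Rightarrow> complex^2^2" where
  "matB l1 l2 = vector [vector [l2, 0], vector [- l2, l1]]"

end

theory Submission
  imports Defs "HOL-Computational_Algebra.Fundamental_Theorem_Algebra"
begin

text \<open>
  For (a), let \<open>a\<close>, \<open>b\<close> be the eigenvalues of \<open>X = \<rho> s1\<close>, let \<open>Y = \<rho> s2\<close>, and take \<open>v \<noteq> 0\<close> with
  \<open>X v = a v\<close>. By irreducibility \<open>v\<close> and \<open>Y v\<close> form a basis. The braid relation makes \<open>Y\<close> conjugate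
  to \<open>X\<close> and \<open>X Y v\<close> an eigenvector of \<open>Y\<close> for \<open>a\<close>; comparing coefficients with Cayley--Hamilton
  forces \<open>X Y v = b Y v - b\<^sup>2 v\<close>, and in the basis \<open>v\<close>, \<open>v - b\<inverse> Y v\<close> the matrices become \<open>A\<close>
  and \<open>B\<close>. An invariant proper subspace is spanned by a common eigenvector of \<open>A\<close> and \<open>B\<close>;
  this can only be \<open>(a, b - a)\<close> up to scaling, and it is one exactly if \<open>a\<^sup>2 - a b + b\<^sup>2 = 0\<close>.
\<close>

section \<open>Homomorphisms from presented groups\<close>

primrec word_eval :: "('a, 'b) monoid_scheme \<Rightarrow> ('g \<Rightarrow> 'a) \<Rightarrow> 'g word \<Rightarrow> 'a" where
  "word_eval G f [] = \<one>\<^bsub>G\<^esub>"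
| "word_eval G f (a # w) =
    (if snd a then f (fst a) else inv\<^bsub>G\<^esub> f (fst a)) \<otimes>\<^bsub>G\<^esub> word_eval G f w"

context group
begin

lemma word_eval_closed:
  assumes "range f \<subseteq> carrier G"
  shows "word_eval G f w \<in> carrier G"
  using assms by (induction w) auto

lemma word_eval_append:
  assumes "range f \<subseteq> carrier G"
  shows "word_eval G f (u @ v) = word_eval G f u \<otimes> word_eval G f v"
proof (induction u)
  case Nil
  show ?case by (simp add: word_eval_closed assms)
next
  case (Cons a u)
  have "f (fst a) \<in> carrier G" using assms by auto
  then show ?case
    by (simp add: Cons.IH m_assoc word_eval_closed[OF assms])
qed

text \<open>Evaluation respects every rule generating \<open>word_eq\<close>: cancellation because
  \<open>G\<close> is a group, the relations by hypothesis. Hence it descends to classes of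
  words.\<close>

lemma word_eval_cong:
  assumes f: "range f \<subseteq> carrier G"
    and R: "\<And>u v. (u, v) \<in> R \<Longrightarrow> word_eval G f u = word_eval G f v"
    and "word_eq R u v"
  shows "word_eval G f u = word_eval G f v"
  using assms(3)
proof (induction rule: word_eq.induct)
  case (cancel x e)
  have "f x \<in> carrier G" using f by auto
  then show ?case by simp
qed (simp_all add: word_eval_append f R)

text \<open>Existence half of the universal property of a presentation.\<close>

lemma presented_group_hom_exists:
  assumes f: "range f \<subseteq> carrier G"
    and R: "\<And>u v. (u, v) \<in> R \<Longrightarrow> word_eval G f u = word_eval G f v"
  shows "\<exists>\<sigma> \<in> hom (presented_group R) G. \<forall>x. \<sigma> (word_class R [(x, True)]) = f x"
proof -
  \<comment> \<open>The choice of representative is harmless: \<open>word_eval_cong\<close> gives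
    all words of a class the same value.\<close>
  define \<sigma> where "\<sigma> X = word_eval G f (SOME w. X = word_class R w)" for X
  have \<sigma>: "\<sigma> (word_class R w) = word_eval G f w" for w
  proof -
    have "word_class R w = word_class R (SOME v. word_class R w = word_class R v)"
      by (rule someI[of "\<lambda>v. word_class R w = word_class R v" w]) simp
    then show ?thesis
      unfolding \<sigma>_def by (intro word_eval_cong[OF f R, symmetric]) (auto simp: word_class_eq_iff)
  qed
  have "\<sigma> \<in> hom (presented_group R) G"
    by (auto simp: hom_def presented_group_simps \<sigma> word_eval_closed f word_eval_append)
  moreover have "\<sigma> (word_class R [(x, True)]) = f x" for x
  proof -
    have "f x \<in> carrier G" using f by auto
    then show ?thesis by (simp add: \<sigma>)
  qed
  ultimately show ?thesis by blast
qed

text \<open>Uniqueness half: a homomorphism is determined by its values on the generators, by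
  induction along the word.\<close>

lemma presented_group_hom_eq_word_eval:
  assumes "\<tau> \<in> hom (presented_group R) G"
  shows "\<tau> (word_class R w) = word_eval G (\<lambda>x. \<tau> (word_class R [(x, True)])) w"
proof (induction w)
  interpret \<tau>: group_hom "presented_group R" G \<tau>
    using assms by (simp add: group_hom_def group_hom_axioms_def group_presented_group is_group)
  {
    case Nil
    show ?case using \<tau>.hom_one by (simp add: presented_group_simps)
  next
    case (Cons a w)
    obtain x e where a: "a = (x, e)" by (cases a)
    have c: "word_class R u \<in> carrier (presented_group R)" for u
      by (simp add: presented_group_simps)
    have "\<tau> (word_class R [(x, False)]) = inv \<tau> (word_class R [(x, True)])"
    proof (rule inv_equality[symmetric])
      have "word_class R [(x, False)] \<otimes>\<^bsub>presented_group R\<^esub> word_class R [(x, True)]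
          = \<one>\<^bsub>presented_group R\<^esub>"
        using word_eq.cancel[of R x False] by (simp add: presented_group_simps word_class_eq_iff)
      then show "\<tau> (word_class R [(x, False)]) \<otimes> \<tau> (word_class R [(x, True)]) = \<one>"
        by (metis \<tau>.hom_mult \<tau>.hom_one c)
    qed (simp_all add: c)
    moreover have "\<tau> (word_class R (a # w)) = \<tau> (word_class R [a]) \<otimes> \<tau> (word_class R w)"
      using \<tau>.hom_mult[OF c c, of "[a]" w] by (simp add: presented_group_simps)
    ultimately show ?case by (simp add: a Cons.IH)
  }
qed

end

section \<open>Homomorphisms out of the braid group\<close>

text \<open>The braid hypothesis is bracketed to the right because \<open>word_eval\<close>
  multiplies in that order.\<close>

lemma B3_hom_exists:
  assumes "group G" "x \<in> carrier G" "y \<in> carrier G"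
    and braid: "x \<otimes>\<^bsub>G\<^esub> (y \<otimes>\<^bsub>G\<^esub> x) = y \<otimes>\<^bsub>G\<^esub> (x \<otimes>\<^bsub>G\<^esub> y)"
  shows "\<exists>\<sigma> \<in> hom B3 G. \<sigma> s1 = x \<and> \<sigma> s2 = y"
proof -
  interpret group G by fact
  define f where "f = (\<lambda>S1 \<Rightarrow> x | S2 \<Rightarrow> y)"
  have f: "range f \<subseteq> carrier G"
    using assms by (auto simp: f_def split: braid_gen.splits)
  have "word_eval G f u = word_eval G f v" if "(u, v) \<in> braid3_rel" for u v
    using that assms by (auto simp: braid3_rel_def f_def)
  from presented_group_hom_exists[OF f this]
  obtain \<sigma> where "\<sigma> \<in> hom B3 G" "\<And>x. \<sigma> (word_class braid3_rel [(x, True)]) = f x"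
    unfolding B3_def by blast
  then show ?thesis by (intro bexI[of _ \<sigma>]) (auto simp: s1_def s2_def f_def)
qed

lemma B3_hom_unique:
  assumes "group G" "\<sigma> \<in> hom B3 G" "\<tau> \<in> hom B3 G" "\<sigma> s1 = \<tau> s1" "\<sigma> s2 = \<tau> s2"
    and "g \<in> carrier B3"
  shows "\<sigma> g = \<tau> g"
proof -
  interpret group G by fact
  obtain w where g: "g = word_class braid3_rel w"
    using assms(6) by (auto simp: B3_def presented_group_simps)
  have "\<sigma> (word_class braid3_rel [(x, True)]) = \<tau> (word_class braid3_rel [(x, True)])" for x
    using assms(4,5) by (cases x) (simp_all add: s1_def s2_def)
  then show ?thesis
    using presented_group_hom_eq_word_eval[OF assms(2)[unfolded B3_def], of w]
      presented_group_hom_eq_word_eval[OF assms(3)[unfolded B3_def], of w]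
    by (simp only: g)
qed

lemma s1_carrier: "s1 \<in> carrier B3" and s2_carrier: "s2 \<in> carrier B3"
  by (simp_all add: s1_def s2_def B3_def presented_group_simps)

lemma braid_relation: "s1 \<otimes>\<^bsub>B3\<^esub> s2 \<otimes>\<^bsub>B3\<^esub> s1 = s2 \<otimes>\<^bsub>B3\<^esub> s1 \<otimes>\<^bsub>B3\<^esub> s2"
  unfolding s1_def s2_def B3_def
  by (auto simp: presented_group_simps word_class_eq_iff braid3_rel_def intro: word_eq.relation)

section \<open>Invariant lines\<close>

lemma matrix_inv_mult:
  fixes M :: "'a::field^'n^'n"
  assumes "invertible M"
  shows "M ** matrix_inv M = mat 1" "matrix_inv M ** M = mat 1"
proof -
  have "M ** matrix_inv M = mat 1 \<and> matrix_inv M ** M = mat 1"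
    unfolding matrix_inv_def using assms unfolding invertible_def by (rule someI_ex)
  then show "M ** matrix_inv M = mat 1" "matrix_inv M ** M = mat 1" by auto
qed

lemma inv_GL:
  fixes M :: "'a::field^'n^'n"
  assumes "invertible M"
  shows "inv\<^bsub>GL\<^esub> M = matrix_inv M"
proof (rule group.inv_equality[OF group_GL])
  show "matrix_inv M \<otimes>\<^bsub>GL\<^esub> M = \<one>\<^bsub>GL\<^esub>" by (simp add: GL_def matrix_inv_mult assms)
  show "M \<in> carrier GL" using assms by (simp add: GL_def)
  show "matrix_inv M \<in> carrier GL"
    using matrix_inv_mult[OF assms] by (auto simp: GL_def invertible_def)
qed

text \<open>This covers the inverse letters of a word. Applying \<open>matrix_inv M\<close> to the
  eigenvalue equation also shows \<open>c \<noteq> 0\<close>, since otherwise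
  \<open>u = 0\<close>.\<close>

lemma matrix_inv_eigenvector:
  fixes M :: "'a::field^'n^'n"
  assumes M: "invertible M" and u: "u \<noteq> 0" "M *v u = c *s u"
  shows "matrix_inv M *v u = inverse c *s u"
proof -
  have "u = matrix_inv M *v (M *v u)"
    by (simp add: matrix_vector_mul_assoc matrix_inv_mult M)
  also have "\<dots> = c *s (matrix_inv M *v u)"
    by (simp add: u(2) vec.scale)
  finally have *: "u = c *s (matrix_inv M *v u)" .
  with u(1) have "c \<noteq> 0" by auto
  with arg_cong[OF *, of "\<lambda>x. inverse c *s x"] show ?thesis by simp
qed

lemma word_eval_GL_eigenvector:
  fixes f :: "'g \<Rightarrow> 'a::field^'n^'n"
  assumes f: "\<And>x. invertible (f x)" and u: "u \<noteq> 0" and eig: "\<And>x. \<exists>c. f x *v u = c *s u"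
  shows "\<exists>c. word_eval GL f w *v u = c *s u"
proof (induction w)
  case Nil
  show ?case by (auto simp: GL_def intro: exI[of _ 1])
next
  case (Cons a w)
  obtain c where c: "word_eval GL f w *v u = c *s u" using Cons.IH by blast
  let ?M = "if snd a then f (fst a) else inv\<^bsub>GL\<^esub> f (fst a)"
  obtain d where "f (fst a) *v u = d *s u" using eig by blast
  then have "\<exists>d. ?M *v u = d *s u"
    using matrix_inv_eigenvector[OF f u] by (auto simp: inv_GL f)
  then obtain d where d: "?M *v u = d *s u" by blast
  have "word_eval GL f (a # w) *v u = ?M *v (word_eval GL f w *v u)"
    by (simp add: GL_def matrix_vector_mul_assoc)
  also have "\<dots> = (c * d) *s u"
    by (simp only: c vec.scale d) (simp add: vec.scale_scale)
  finally show ?case by blast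
qed

section \<open>Linear algebra of the plane\<close>

text \<open>The determinant with columns \<open>v\<close> and \<open>w\<close>; over a field it is
  nonzero exactly when they form a basis.\<close>

definition wedge :: "'a::comm_ring_1^2 \<Rightarrow> 'a^2 \<Rightarrow> 'a" where
  "wedge v w = v $ 1 * w $ 2 - v $ 2 * w $ 1"

text \<open>Cramer's rule, obtained by dividing a polynomial identity by
  \<open>wedge v w\<close>.\<close>

lemma wedge_decompose:
  fixes v w x :: "'a::field^2"
  assumes "wedge v w \<noteq> 0"
  shows "x = (wedge x w / wedge v w) *s v + (wedge v x / wedge v w) *s w"
proof -
  have "wedge v w *s x = wedge x w *s v + wedge v x *s w"
    by (simp add: vec_eq_iff forall_2 wedge_def algebra_simps)
  from arg_cong[OF this, of "\<lambda>y. inverse (wedge v w) *s y"] show ?thesis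
    using assms by (simp add: vec.scale_right_distrib divide_inverse mult.commute)
qed

lemma wedge_eq_0_imp_parallel:
  fixes v w :: "'a::field^2"
  assumes "wedge v w = 0" "v \<noteq> 0"
  shows "\<exists>c. w = c *s v"
proof (cases "v $ 1 = 0")
  case True
  with assms have "v $ 2 \<noteq> 0" "w $ 1 = 0"
    by (auto simp: vec_eq_iff forall_2 wedge_def)
  with True show ?thesis
    by (intro exI[of _ "w $ 2 / v $ 2"]) (simp add: vec_eq_iff forall_2)
next
  case False
  with assms show ?thesis
    by (intro exI[of _ "w $ 1 / v $ 1"]) (simp add: vec_eq_iff forall_2 wedge_def field_simps)
qed

text \<open>Wedging with \<open>w\<close> on the right or \<open>v\<close> on the left isolates one
  coefficient.\<close>

lemma combination_eq_iff:
  fixes v w :: "'a::field^2"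
  assumes "wedge v w \<noteq> 0"
  shows "a *s v + b *s w = c *s v + d *s w \<longleftrightarrow> a = c \<and> b = d"
proof
  assume eq: "a *s v + b *s w = c *s v + d *s w"
  have "wedge (a *s v + b *s w) w = a * wedge v w" "wedge v (a *s v + b *s w) = b * wedge v w"
    for a b by (simp_all add: wedge_def algebra_simps)
  with eq assms show "a = c \<and> b = d" by (metis mult_right_cancel)
qed simp

lemma subspace_eq_UNIV:
  fixes W :: "('a::field^2) set"
  assumes "vec.subspace W" "v \<in> W" "w \<in> W" "wedge v w \<noteq> 0"
  shows "W = UNIV"
proof -
  have "x \<in> W" for x
    by (subst wedge_decompose[OF assms(4)])
      (intro vec.subspace_add vec.subspace_scale assms)
  then show ?thesis by blast
qed

lemma line_neq_UNIV:
  fixes u :: "'a::field^2"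
  shows "range (\<lambda>c. c *s u) \<noteq> UNIV"
proof
  assume "range (\<lambda>c. c *s u) = UNIV"
  then obtain c d where "axis 1 1 = c *s u" "axis 2 1 = d *s u" by blast
  then have "wedge (axis 1 1) (axis 2 1 :: 'a^2) = 0" by (simp add: wedge_def)
  then show False by (simp add: wedge_def axis_def)
qed

text \<open>Every element of \<open>B3\<close> is a word in the generators and their inverses, so
  the line through \<open>u\<close> is invariant under the whole group, yet neither zero nor the
  plane.\<close>

lemma irreducible_no_common_eigenvector:
  fixes \<rho> :: "braid_gen word set \<Rightarrow> 'a::field^2^2"
  assumes irr: "irreducible_rep B3 \<rho>" and u: "u \<noteq> 0"
    and c: "\<rho> s1 *v u = c *s u" and d: "\<rho> s2 *v u = d *s u"
  shows False
proof -
  have hom: "\<rho> \<in> hom B3 GL" using irr by (simp add: irreducible_rep_def)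
  let ?f = "\<lambda>x. \<rho> (word_class braid3_rel [(x, True)])"
  have f: "invertible (?f x)" for x
  proof -
    have "?f x \<in> carrier GL"
      by (rule hom_in_carrier[OF hom]) (simp add: B3_def presented_group_simps)
    then show ?thesis by (simp add: GL_def)
  qed
  have eig: "\<exists>c. ?f x *v u = c *s u" for x
    using c d by (cases x) (auto simp: s1_def s2_def)
  have g: "\<exists>c. \<rho> g *v u = c *s u" if g: "g \<in> carrier B3" for g
  proof -
    obtain w where w: "g = word_class braid3_rel w"
      using g by (auto simp: B3_def presented_group_simps)
    have "\<rho> g = word_eval GL ?f w"
      unfolding w
      by (rule group.presented_group_hom_eq_word_eval[OF group_GL hom[unfolded B3_def]])
    then show ?thesis
      using word_eval_GL_eigenvector[of ?f u w, OF f u eig] by (simp only:)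
  qed
  let ?W = "range (\<lambda>c. c *s u)"
  have "vec.subspace ?W"
    using vec.subspace_span[of "{u}"] by (simp add: vec.span_singleton)
  moreover have "\<forall>g\<in>carrier B3. \<forall>w\<in>?W. \<rho> g *v w \<in> ?W"
  proof (clarify)
    fix g k assume "g \<in> carrier B3"
    then obtain c where c: "\<rho> g *v u = c *s u" using g by blast
    have "\<rho> g *v (k *s u) = (k * c) *s u" by (simp only: vec.scale c vec.scale_scale)
    then show "\<rho> g *v (k *s u) \<in> ?W" by blast
  qed
  ultimately have "?W = {0} \<or> ?W = UNIV"
    using irr unfolding irreducible_rep_def by blast
  moreover have "u \<in> ?W" by (rule range_eqI[of _ _ 1]) simp
  ultimately show False using line_neq_UNIV u by auto
qed

section \<open>Two-by-two matrices\<close>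

lemma charpoly_2: "charpoly (M :: 'a::field^2^2) = [:det M, - trace M, 1:]"
  by (simp add: charpoly_def det_2 trace_def sum_2 algebra_simps)

text \<open>Over the complex numbers the characteristic polynomial is monic and splits, so it is
  \<open>(x - a) (x - b)\<close>; compare coefficients.\<close>

lemma eigenvalues_trace_det:
  fixes M :: "complex^2^2"
  assumes "eigenvalues M = {#a, b#}"
  shows "trace M = a + b" "det M = a * b"
proof -
  have "charpoly M = smult (lead_coeff (charpoly M)) (\<Prod>x\<in>#proots (charpoly M). [:- x, 1:])"
    by (rule complex_poly_decompose_multiset[symmetric])
  also have "\<dots> = [:a * b, - (a + b), 1:]"
    using assms by (simp add: eigenvalues_def charpoly_2)
  finally show "trace M = a + b" "det M = a * b"
    unfolding charpoly_2 by (simp_all only: pCons_eq_iff neg_equal_iff_equal)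
qed

lemma cayley_hamilton_2:
  fixes M :: "'a::comm_ring_1^2^2"
  shows "M *v (M *v v) = trace M *s (M *v v) - det M *s v"
  by (simp add: vec_eq_iff forall_2 matrix_vector_mult_def sum_2 trace_def det_2 algebra_simps)

text \<open>A linear map acts as a derivation on the second exterior power, which is
  one-dimensional, by the scalar \<open>trace M\<close>.\<close>

lemma trace_wedge:
  fixes M :: "'a::comm_ring_1^2^2"
  shows "wedge (M *v v) w + wedge v (M *v w) = trace M * wedge v w"
  by (simp add: wedge_def matrix_vector_mult_def sum_2 trace_def algebra_simps)

text \<open>By Cayley-Hamilton \<open>(M - a) (M - b) = 0\<close>, so any nonzero value of
  \<open>M - b\<close> is an eigenvector for \<open>a\<close>.\<close>

lemma eigenvector_exists_2:
  fixes M :: "'a::field^2^2"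
  assumes "trace M = a + b" "det M = a * b"
  shows "\<exists>v. v \<noteq> 0 \<and> M *v v = a *s v"
proof (cases "\<exists>x. M *v x \<noteq> b *s x")
  case True
  then obtain x where x: "M *v x - b *s x \<noteq> 0" by auto
  have "M *v (M *v x - b *s x) = a *s (M *v x - b *s x)"
    by (simp add: vec.diff vec.scale cayley_hamilton_2 assms vec_eq_iff algebra_simps)
  with x show ?thesis by blast
next
  case False
  \<comment> \<open>Here \<open>M\<close> is the scalar \<open>b\<close>, so the trace identity
    reads \<open>b + b = a + b\<close>.\<close>
  have "wedge (M *v axis 1 1) (axis 2 1) + wedge (axis 1 1) (M *v axis 2 1)
      = trace M * wedge (axis 1 1) (axis 2 1)"
    by (rule trace_wedge)
  with False have "a = b" by (simp add: wedge_def axis_def assms)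
  with False show ?thesis by (intro exI[of _ "axis 1 1"]) (auto simp: axis_eq_0_iff)
qed

text \<open>The braid relation says \<open>(X Y) X = Y (X Y)\<close>, so \<open>X Y\<close>
  conjugates \<open>X\<close> into \<open>Y\<close>.\<close>

lemma braid_trace_det:
  fixes X Y :: "'a::field^'n^'n"
  assumes "invertible X" "invertible Y" and braid: "X ** Y ** X = Y ** X ** Y"
  shows "trace Y = trace X" "det Y = det X"
proof -
  have XY: "invertible (X ** Y)" by (simp add: invertible_mult assms)
  have "trace Y = trace (Y ** ((X ** Y) ** matrix_inv (X ** Y)))"
    by (simp add: matrix_inv_mult XY)
  also have "\<dots> = trace ((X ** Y ** X) ** matrix_inv (X ** Y))"
    by (simp only: braid matrix_mul_assoc)
  also have "\<dots> = trace (matrix_inv (X ** Y) ** (X ** Y ** X))"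
    by (rule trace_mul_sym)
  also have "\<dots> = trace X"
    by (simp add: matrix_mul_assoc[of _ "X ** Y" X] matrix_inv_mult XY)
  finally show "trace Y = trace X" .
  have "det X \<noteq> 0" "det Y \<noteq> 0"
    using assms invertible_det_nz by blast+
  with arg_cong[OF braid, of det] show "det Y = det X" by (simp add: det_mul)
qed

lemma equivalent_rep_conjugate:
  assumes hom: "\<rho> \<in> hom G GL" and Q: "invertible Q"
  defines "\<sigma> \<equiv> \<lambda>g. matrix_inv Q ** \<rho> g ** Q"
  shows "\<sigma> \<in> hom G GL" "equivalent_rep G \<rho> \<sigma>"
proof -
  note QQ = matrix_inv_mult[OF Q]
  have P: "invertible (matrix_inv Q)" using QQ by (auto simp: invertible_def)
  \<comment> \<open>The conjugating matrix in \<open>equivalent_rep\<close> is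
    \<open>matrix_inv Q\<close>, whose inverse must be identified with \<open>Q\<close>.\<close>
  have "matrix_inv (matrix_inv Q) = (matrix_inv (matrix_inv Q)) ** (matrix_inv Q ** Q)"
    by (simp add: QQ)
  also have "\<dots> = Q"
    by (simp add: matrix_mul_assoc matrix_inv_mult P)
  finally have "matrix_inv (matrix_inv Q) = Q" .
  with P show "equivalent_rep G \<rho> \<sigma>"
    unfolding equivalent_rep_def \<sigma>_def by (intro exI[of _ "matrix_inv Q"]) simp
  have "\<sigma> (x \<otimes>\<^bsub>G\<^esub> y) = \<sigma> x ** \<sigma> y" if "x \<in> carrier G" "y \<in> carrier G" for x y
  proof -
    have "\<sigma> x ** \<sigma> y = matrix_inv Q ** \<rho> x ** (Q ** matrix_inv Q) ** \<rho> y ** Q"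
      by (simp add: \<sigma>_def matrix_mul_assoc)
    also have "\<dots> = \<sigma> (x \<otimes>\<^bsub>G\<^esub> y)"
      using hom_mult[OF hom that] by (simp add: QQ \<sigma>_def GL_def matrix_mul_assoc)
    finally show ?thesis by simp
  qed
  moreover have "invertible (\<sigma> x)" if "x \<in> carrier G" for x
    using hom_in_carrier[OF hom that] P Q by (simp add: \<sigma>_def GL_def invertible_mult)
  ultimately show "\<sigma> \<in> hom G GL" by (auto simp: hom_def GL_def)
qed

section \<open>The two-dimensional representations\<close>

lemma matA_entries:
  "matA a b $ 1 $ 1 = a" "matA a b $ 1 $ 2 = a" "matA a b $ 2 $ 1 = 0" "matA a b $ 2 $ 2 = b"
  by (simp_all add: matA_def)

lemma matB_entries:
  "matB a b $ 1 $ 1 = b" "matB a b $ 1 $ 2 = 0" "matB a b $ 2 $ 1 = - b" "matB a b $ 2 $ 2 = a"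
  by (simp_all add: matB_def)

lemmas mat_entries = matA_entries matB_entries

lemma matA_matB_braid:
  "matA a b ** (matB a b ** matA a b) = matB a b ** (matA a b ** matB a b)"
  by (simp add: vec_eq_iff forall_2 matrix_matrix_mult_def sum_2 mat_entries)

lemma invertible_matA_matB:
  assumes "a \<noteq> 0" "b \<noteq> 0"
  shows "invertible (matA a b)" "invertible (matB a b)"
  using assms by (simp_all add: invertible_det_nz det_2 mat_entries)

text \<open>The vanishing wedges say that \<open>w\<close> is an eigenvector of both matrices. Both
  its coordinates are then nonzero, and two linear equations between them remain.\<close>

lemma matA_matB_invariant_line:
  assumes "w \<noteq> 0" "a \<noteq> 0" "b \<noteq> 0"
    and A: "wedge w (matA a b *v w) = 0" and B: "wedge w (matB a b *v w) = 0"
  shows "a\<^sup>2 - a * b + b\<^sup>2 = 0"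
proof -
  have A': "w $ 2 * (b * w $ 1 - a * (w $ 1 + w $ 2)) = 0"
    using A by (simp add: wedge_def matrix_vector_mult_def sum_2 mat_entries algebra_simps)
  have B': "w $ 1 * (a * w $ 2 - b * w $ 1 - b * w $ 2) = 0"
    using B by (simp add: wedge_def matrix_vector_mult_def sum_2 mat_entries algebra_simps)
  have w: "w $ 1 \<noteq> 0 \<or> w $ 2 \<noteq> 0"
    using assms(1) by (simp add: vec_eq_iff forall_2)
  have w2: "w $ 2 \<noteq> 0" using B' w assms by auto
  have A'': "b * w $ 1 - a * w $ 1 = a * w $ 2" using A' w2 by (simp add: distrib_left)
  have w1: "w $ 1 \<noteq> 0" using A'' w2 assms by auto
  have B'': "a * w $ 2 - b * w $ 2 = b * w $ 1"
    using B' w1 by (simp add: diff_eq_eq add.commute)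
  \<comment> \<open>Multiply \<open>A''\<close> by \<open>b\<close> and replace
    \<open>b * w $ 1\<close> by means of \<open>B''\<close>.\<close>
  have "(a\<^sup>2 - a * b + b\<^sup>2) * w $ 2 = 0"
    using A'' B'' by algebra
  then show ?thesis using w2 by simp
qed

text \<open>In a proper invariant subspace any nonzero \<open>w\<close> is parallel to its images
  under both matrices, as two independent vectors would span the plane.\<close>

lemma irreducible_standard_rep:
  assumes \<sigma>: "\<sigma> \<in> hom B3 GL" "\<sigma> s1 = matA a b" "\<sigma> s2 = matB a b"
    and "a \<noteq> 0" "b \<noteq> 0" and nz: "a\<^sup>2 - a * b + b\<^sup>2 \<noteq> 0"
  shows "irreducible_rep B3 \<sigma>"
  unfolding irreducible_rep_def
proof (intro conjI allI impI)
  fix W :: "(complex^2) set"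
  assume W: "vec.subspace W \<and> (\<forall>g\<in>carrier B3. \<forall>w\<in>W. \<sigma> g *v w \<in> W)"
  show "W = {0} \<or> W = UNIV"
  proof (rule ccontr)
    assume neq: "\<not> (W = {0} \<or> W = UNIV)"
    then obtain w where w: "w \<in> W" "w \<noteq> 0"
      using W vec.subspace_0 by blast
    have "matA a b *v w \<in> W" "matB a b *v w \<in> W"
      using W w s1_carrier s2_carrier \<sigma> by metis+
    then have "wedge w (matA a b *v w) = 0" "wedge w (matB a b *v w) = 0"
      using subspace_eq_UNIV W w neq by blast+
    with matA_matB_invariant_line w assms show False by blast
  qed
qed (rule \<sigma>)

section \<open>Change of basis and the normal form\<close>

text \<open>The columns of \<open>N\<close> hold the coordinates of \<open>M v\<close> and
  \<open>M w\<close> with respect to \<open>v\<close>, \<open>w\<close>, which are the columns of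
  \<open>Q\<close>.\<close>

lemma columns_2_mult:
  fixes M N :: "'a::comm_ring_1^2^2"
  assumes "M *v v = N $ 1 $ 1 *s v + N $ 2 $ 1 *s w"
    and "M *v w = N $ 1 $ 2 *s v + N $ 2 $ 2 *s w"
  defines "Q \<equiv> \<chi> i j. if j = 1 then v $ i else w $ i"
  shows "M ** Q = Q ** N"
  using assms(1,2)
  by (simp add: Q_def vec_eq_iff forall_2 matrix_matrix_mult_def matrix_vector_mult_def sum_2
      mult.commute)

lemma irreducible_rep_normal_form:
  fixes \<rho> :: "braid_gen word set \<Rightarrow> complex^2^2"
  assumes irr: "irreducible_rep B3 \<rho>" and eig: "eigenvalues (\<rho> s1) = {#a, b#}"
  shows "a\<^sup>2 - a * b + b\<^sup>2 \<noteq> 0 \<and>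
    (\<exists>\<sigma> \<in> hom B3 GL. \<sigma> s1 = matA a b \<and> \<sigma> s2 = matB a b \<and> equivalent_rep B3 \<rho> \<sigma>)"
proof -
  define X Y where "X = \<rho> s1" and "Y = \<rho> s2"
  have hom: "\<rho> \<in> hom B3 GL" using irr by (simp add: irreducible_rep_def)
  interpret B: group B3 unfolding B3_def by (rule group_presented_group)
  have inv: "invertible X" "invertible Y"
    using hom_in_carrier[OF hom s1_carrier] hom_in_carrier[OF hom s2_carrier]
    by (simp_all add: X_def Y_def GL_def)
  have braid: "X ** Y ** X = Y ** X ** Y"
    using arg_cong[OF braid_relation, of \<rho>]
    by (simp add: hom_mult[OF hom] s1_carrier s2_carrier X_def Y_def) (simp add: GL_def)
  have X: "trace X = a + b" "det X = a * b"
    using eigenvalues_trace_det[OF eig] by (simp_all add: X_def)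
  have Y: "trace Y = a + b" "det Y = a * b"
    using braid_trace_det[OF inv braid] X by simp_all
  have ab: "a \<noteq> 0" "b \<noteq> 0"
    using inv(1) X(2) by (auto simp: invertible_det_nz)
  obtain v where v: "v \<noteq> 0" "X *v v = a *s v"
    using eigenvector_exists_2[OF X] by blast
  define u where "u = Y *v v"
  have indep: "wedge v u \<noteq> 0"
  proof
    assume "wedge v u = 0"
    then obtain d where "Y *v v = d *s v"
      using wedge_eq_0_imp_parallel v(1) unfolding u_def by blast
    then show False
      using irreducible_no_common_eigenvector[OF irr v(1)] v(2) unfolding X_def Y_def by blast
  qed
  have Yu: "Y *v u = (- (a * b)) *s v + (a + b) *s u"
    unfolding u_def by (simp add: cayley_hamilton_2 Y vec_eq_iff)
  obtain \<alpha> \<beta> where Xu: "X *v u = \<alpha> *s v + \<beta> *s u"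
    using wedge_decompose[OF indep] by blast
  \<comment> \<open>In the basis \<open>v\<close>, \<open>u\<close> the matrix of \<open>X\<close>
    is triangular with diagonal \<open>a\<close>, \<open>\<beta>\<close>; the trace gives
    \<open>\<beta> = b\<close>.\<close>
  have "wedge (a *s v) u + wedge v (\<alpha> *s v + \<beta> *s u) = (a + b) * wedge v u"
    using trace_wedge[of X v u] by (simp add: v Xu X)
  then have "(\<beta> - b) * wedge v u = 0"
    by (simp add: wedge_def algebra_simps)
  with indep have \<beta>: "\<beta> = b" by simp
  \<comment> \<open>\<open>Y X Y v = X Y X v = a X Y v\<close>.\<close>
  have "Y *v (X *v u) = a *s (X *v u)"
  proof -
    have "Y *v (X *v u) = (Y ** X ** Y) *v v"
      by (simp add: u_def matrix_vector_mul_assoc matrix_mul_assoc)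
    also have "\<dots> = X *v (Y *v (X *v v))"
      by (simp add: braid[symmetric] matrix_vector_mul_assoc matrix_mul_assoc)
    finally show ?thesis by (simp add: v u_def vec.scale)
  qed
  \<comment> \<open>Expand both sides in the basis \<open>v\<close>, \<open>u\<close>; the
    coefficient of \<open>u\<close> determines \<open>\<alpha>\<close>.\<close>
  then have "(- (a * b * b)) *s v + (\<alpha> + b * (a + b)) *s u = (a * \<alpha>) *s v + (a * b) *s u"
    by (simp add: Xu \<beta> vec.add vec.scale Yu u_def[symmetric])
      (simp add: vec_eq_iff algebra_simps)
  then have "\<alpha> + b * (a + b) = a * b" by (simp only: combination_eq_iff[OF indep])
  then have \<alpha>: "\<alpha> = - b\<^sup>2" by (simp add: algebra_simps power2_eq_square eq_neg_iff_add_eq_0)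

  \<comment> \<open>Solved from \<open>Y v = b v - b f\<close>, the first column of
    \<open>matB\<close>; the other three columns then come out right.\<close>
  define f where "f = v - inverse b *s u"
  have u: "u = b *s v - b *s f" using ab by (simp add: f_def vec_eq_iff algebra_simps)
  have f: "wedge v f \<noteq> 0"
    using indep ab by (simp add: f_def wedge_def algebra_simps)
  have Xf: "X *v f = a *s v + b *s f"
    unfolding f_def using ab
    by (simp add: vec.diff vec.scale v Xu \<alpha> \<beta> vec_eq_iff field_simps power2_eq_square)
  have Yv: "Y *v v = b *s v + (- b) *s f"
    using u by (simp add: u_def)
  have Yf: "Y *v f = a *s f"
    unfolding f_def using ab
    by (simp add: vec.diff vec.scale Yu u_def[symmetric] vec_eq_iff field_simps)

  define Q :: "complex^2^2" where "Q = (\<chi> i j. if j = 1 then v $ i else f $ i)"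
  have Q: "invertible Q"
    using f by (simp add: Q_def invertible_det_nz det_2 wedge_def mult.commute)
  have XQ: "X ** Q = Q ** matA a b"
    unfolding Q_def by (rule columns_2_mult) (simp_all add: v Xf mat_entries)
  have YQ: "Y ** Q = Q ** matB a b"
    unfolding Q_def by (rule columns_2_mult) (simp_all add: Yv Yf mat_entries)
  have conj: "matrix_inv Q ** M ** Q = N" if "M ** Q = Q ** N" for M N
    using that by (metis matrix_inv_mult(2)[OF Q] matrix_mul_assoc matrix_mul_lid)
  have "\<exists>\<sigma> \<in> hom B3 GL. \<sigma> s1 = matA a b \<and> \<sigma> s2 = matB a b \<and> equivalent_rep B3 \<rho> \<sigma>"
    using equivalent_rep_conjugate[OF hom Q] conj[OF XQ] conj[OF YQ] X_def Y_def
    by (intro bexI[of _ "\<lambda>g. matrix_inv Q ** \<rho> g ** Q"]) simp_all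
  moreover have "a\<^sup>2 - a * b + b\<^sup>2 \<noteq> 0"
  proof
    assume zero: "a\<^sup>2 - a * b + b\<^sup>2 = 0"
    define d where "d = b - a"
    \<comment> \<open>The eigenvector of \<open>matA\<close> for \<open>b\<close>, with coordinates
      \<open>(a, b - a)\<close>. It is nonzero because \<open>a\<close> is.\<close>
    let ?x = "a *s v + d *s f"
    have "wedge ?x f = a * wedge v f" by (simp add: wedge_def algebra_simps)
    moreover have "wedge 0 f = 0" by (simp add: wedge_def)
    ultimately have x: "?x \<noteq> 0" using ab f by (metis mult_eq_0_iff)
    have "X *v ?x = (a * a + d * a) *s v + (d * b) *s f"
      by (simp add: vec.add vec.scale v Xf vec_eq_iff algebra_simps)
    also have "a * a + d * a = b * a" by (simp add: d_def algebra_simps)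
    also have "(b * a) *s v + (d * b) *s f = b *s ?x"
      by (simp add: vec.scale_right_distrib mult.commute)
    finally have "X *v ?x = b *s ?x" .
    have "Y *v ?x = (b * a) *s v + (d * a - a * b) *s f"
      by (simp add: vec.add vec.scale Yv Yf vec_eq_iff algebra_simps)
    \<comment> \<open>The left side is \<open>- a^2\<close> and the right side
      \<open>b^2 - a b\<close>: this is the vanishing quadratic form.\<close>
    also have "d * a - a * b = b * d"
      using zero by (simp add: d_def algebra_simps power2_eq_square)
    also have "(b * a) *s v + (b * d) *s f = b *s ?x"
      by (simp add: vec.scale_right_distrib)
    finally have "Y *v ?x = b *s ?x" .
    with \<open>X *v ?x = b *s ?x\<close> show False
      using irreducible_no_common_eigenvector[OF irr x] unfolding X_def Y_def by blast
  qed
  ultimately show ?thesis by blast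
qed

theorem mainTheorem17:
  shows "(\<forall>(\<rho> :: braid_gen word set \<Rightarrow> complex^2^2) l1 l2.
            irreducible_rep B3 \<rho> \<and> eigenvalues (\<rho> s1) = {#l1, l2#} \<longrightarrow>
            l1^2 - l1 * l2 + l2^2 \<noteq> 0 \<and>
            (\<exists>\<sigma> \<in> hom B3 GL. \<sigma> s1 = matA l1 l2 \<and> \<sigma> s2 = matB l1 l2 \<and> equivalent_rep B3 \<rho> \<sigma>))
       \<and> (\<forall>l1 l2 :: complex.
            l1 \<noteq> 0 \<and> l2 \<noteq> 0 \<and> l1^2 - l1 * l2 + l2^2 \<noteq> 0 \<longrightarrow>
            (\<exists>\<sigma> \<in> hom B3 GL. \<sigma> s1 = matA l1 l2 \<and> \<sigma> s2 = matB l1 l2 \<and> irreducible_rep B3 \<sigma> \<and>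
               (\<forall>\<tau> \<in> hom B3 GL. \<tau> s1 = matA l1 l2 \<and> \<tau> s2 = matB l1 l2 \<longrightarrow>
                  (\<forall>g \<in> carrier B3. \<tau> g = \<sigma> g))))"
proof (intro conjI allI impI)
  fix l1 l2 :: complex
  assume l: "l1 \<noteq> 0 \<and> l2 \<noteq> 0 \<and> l1^2 - l1 * l2 + l2^2 \<noteq> 0"
  obtain \<sigma> :: "braid_gen word set \<Rightarrow> complex^2^2"
    where \<sigma>: "\<sigma> \<in> hom B3 GL" "\<sigma> s1 = matA l1 l2" "\<sigma> s2 = matB l1 l2"
    using B3_hom_exists[OF group_GL, of "matA l1 l2" "matB l1 l2"] l
      invertible_matA_matB[of l1 l2] matA_matB_braid[of l1 l2]
    by (auto simp: GL_def)
  moreover have "irreducible_rep B3 \<sigma>"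
    using irreducible_standard_rep \<sigma> l by blast
  \<comment> \<open>Equality is claimed only on \<open>carrier B3\<close>, since a homomorphism may
    take arbitrary values elsewhere.\<close>
  moreover have "\<tau> g = \<sigma> g"
    if "\<tau> \<in> hom B3 GL" "\<tau> s1 = matA l1 l2 \<and> \<tau> s2 = matB l1 l2" "g \<in> carrier B3" for \<tau> g
    using B3_hom_unique[OF group_GL that(1) \<sigma>(1)] that \<sigma> by simp
  ultimately show "\<exists>\<sigma> \<in> hom B3 GL. \<sigma> s1 = matA l1 l2 \<and> \<sigma> s2 = matB l1 l2 \<and> irreducible_rep B3 \<sigma> \<and>
               (\<forall>\<tau> \<in> hom B3 GL. \<tau> s1 = matA l1 l2 \<and> \<tau> s2 = matB l1 l2 \<longrightarrow>
                  (\<forall>g \<in> carrier B3. \<tau> g = \<sigma> g))"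
    by blast
qed (use irreducible_rep_normal_form in blast)+

end
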